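(* Let $\beta=0$, $L_0=\frac{4\pi}{\sqrt3}$, $D_{L_0}=\mathbb T_{L_0}\times[-\pi,\pi]$, and let $u_{\rm k}(y)=\sin(y)$ for $y\in[-\pi,\pi]$ (the Kolmogorov flow). (i) For any $\delta>0$, if a traveling-wave solution $(u(x-ct,y),v(x-ct,y))\in C^2(D_{L_0})$ to the $\beta$-plane equation (with $\beta=0$) in $D_{L_0}$ with $v=0$ on $y=\pm\pi$ satisfies $c\in(-\infty,-\delta]\cup[\delta,\infty)$ and $$\|u-u_{\rm k}\|_{C^2(D_{L_0})}<\delta,$$ then $(u(x-ct,y),v(x-ct,y))$ is a shear flow. (ii) For any $\varepsilon\in\mathbb R$, $$(u_\varepsilon,v_\varepsilon)=\left(\sin(y)+\frac{\varepsilon}{2}\sin\left(\frac y2\right)\sin\left(\frac{\sqrt3}{2}x\right),\ \frac{\sqrt3\,\varepsilon}{2}\cos\left(\frac y2\right)\cos\left(\frac{\sqrt3}{2}x\right)\right)$$ is a non-sheared steady solution to the $\beta$-plane equation (with $\beta=0$) in $D_{L_0}$ with $v=0$ on $y=\pm\pi$. In particular, for $\varepsilon$ small enough, the non-sheared steady flow $(u_\varepsilon,v_\varepsilon)$ is sufficiently close in analytic regularity to the Kolmogorov flow $(u_{\rm k},0)$.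
   Context: $\mathbb T_L=\mathbb R/L\mathbb Z$. The $\beta$-plane equation with $\beta=0$ ($f$-plane setting) is $$u_t+uu_x+vu_y=-P_x,\quad v_t+uv_x+vv_y=-P_y,\quad u_x+v_y=0,$$ where $(u,v)$ is the velocity and $P$ the pressure, here with boundary condition $v=0$ on $y=\pm\pi$. A traveling-wave solution with wave speed $c\in\mathbb R$ is a solution of the form $(u(x-ct,y),v(x-ct,y))$, with profile $(u,v)$ that is $L_0$-periodic in the first variable. A steady solution is a time-independent one. A flow is a shear flow if $v\equiv0$ throughout the domain (so that $u$ depends only on $y$), and non-sheared otherwise. The function $u_{\rm k}=u_{\rm k}(y)$ is regarded as a function on $D_{L_0}$ independent of $x$. The $C^2(D_{L_0})$ norm is the sum of the sup norms of all partial derivatives of order at most $2$.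
   Formalization: In (ii), "non-sheared" is claimed only for ε ≠ 0, since at ε = 0 the flow is (sin y, 0), which is a shear flow; the steady-solution claim is kept for every real ε. *)

theory Defs
  imports "HOL-Analysis.Analysis"
begin

text \<open>
  A function on the channel T_L x [-pi, pi] is represented by a function of two real
  arguments that is L-periodic in the first one; only its values for second argument
  in [-pi, pi] matter.
\<close>

definition periodic_x :: "real \<Rightarrow> (real \<Rightarrow> real \<Rightarrow> real) \<Rightarrow> bool" where
  "periodic_x L f \<longleftrightarrow> (\<forall>x. \<forall>y\<in>{-pi..pi}. f (x + L) y = f x y)"

definition dx :: "(real \<Rightarrow> real \<Rightarrow> real) \<Rightarrow> real \<Rightarrow> real \<Rightarrow> real" where
  "dx f = (\<lambda>x y. deriv (\<lambda>s. f s y) x)"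

text \<open>One-sided at the walls, so that it depends only on the values of f in the channel.\<close>

definition dy :: "(real \<Rightarrow> real \<Rightarrow> real) \<Rightarrow> real \<Rightarrow> real \<Rightarrow> real" where
  "dy f = (\<lambda>x y. vector_derivative (\<lambda>s. f x s) (at y within {-pi..pi}))"

definition has_partials :: "(real \<Rightarrow> real \<Rightarrow> real) \<Rightarrow> bool" where
  "has_partials f \<longleftrightarrow> (\<forall>x. \<forall>y\<in>{-pi..pi}.
     (\<lambda>s. f s y) differentiable (at x) \<and>
     (\<lambda>s. f x s) differentiable (at y within {-pi..pi}))"

text \<open>Class C^k up to the walls.\<close>

primrec Ck :: "nat \<Rightarrow> (real \<Rightarrow> real \<Rightarrow> real) \<Rightarrow> bool" where
  "Ck 0 f \<longleftrightarrow> continuous_on (UNIV \<times> {-pi..pi}) (\<lambda>(x, y). f x y)"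
| "Ck (Suc k) f \<longleftrightarrow>
     continuous_on (UNIV \<times> {-pi..pi}) (\<lambda>(x, y). f x y) \<and>
     has_partials f \<and> Ck k (dx f) \<and> Ck k (dy f)"

text \<open>
  Norms take values in \<^typ>\<open>ennreal\<close>, so that an unbounded function has norm
  \<^term>\<open>\<infinity> :: ennreal\<close> rather than an unspecified one.
\<close>

definition sup_norm :: "(real \<Rightarrow> real \<Rightarrow> real) \<Rightarrow> ennreal" where
  "sup_norm f = (SUP (x, y)\<in>UNIV \<times> {-pi..pi}. ennreal \<bar>f x y\<bar>)"

definition Ck_norm :: "nat \<Rightarrow> (real \<Rightarrow> real \<Rightarrow> real) \<Rightarrow> ennreal" where
  "Ck_norm k f = (\<Sum>(i, j)\<in>{(i, j). i + j \<le> k}. sup_norm ((dx ^^ i) ((dy ^^ j) f)))"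

text \<open>
  The norm of real-analytic functions with radius parameter r: for smooth f its finiteness
  bounds the derivative of multi-index (i, j) by a multiple of i! j! / r^(i+j).
\<close>

definition analytic_norm :: "real \<Rightarrow> (real \<Rightarrow> real \<Rightarrow> real) \<Rightarrow> ennreal" where
  "analytic_norm r f =
     (\<Sum>i. \<Sum>j. ennreal (r ^ (i + j) / (fact i * fact j)) * sup_norm ((dx ^^ i) ((dy ^^ j) f)))"

text \<open>
  Classical solutions \<open>U t x y\<close>, \<open>V t x y\<close> of the beta-plane equation with beta = 0
  on T_L x [-pi, pi], with some pressure \<open>P t x y\<close> on the same domain.
\<close>

definition f_plane_solution ::
  "real \<Rightarrow> (real \<Rightarrow> real \<Rightarrow> real \<Rightarrow> real) \<Rightarrow> (real \<Rightarrow> real \<Rightarrow> real \<Rightarrow> real) \<Rightarrow> bool" where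
  "f_plane_solution L U V \<longleftrightarrow>
     (\<forall>t. periodic_x L (U t) \<and> periodic_x L (V t) \<and> Ck 1 (U t) \<and> Ck 1 (V t)) \<and>
     (\<forall>t x. \<forall>y\<in>{-pi..pi}.
        (\<lambda>s. U s x y) differentiable (at t) \<and> (\<lambda>s. V s x y) differentiable (at t)) \<and>
     (\<exists>P. (\<forall>t. periodic_x L (P t) \<and> Ck 1 (P t)) \<and>
        (\<forall>t x. \<forall>y\<in>{-pi..pi}.
           deriv (\<lambda>s. U s x y) t + U t x y * dx (U t) x y + V t x y * dy (U t) x y
             = - dx (P t) x y \<and>
           deriv (\<lambda>s. V s x y) t + U t x y * dx (V t) x y + V t x y * dy (V t) x y
             = - dy (P t) x y)) \<and>
     (\<forall>t x. \<forall>y\<in>{-pi..pi}. dx (U t) x y + dy (V t) x y = 0) \<and>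
     (\<forall>t x. V t x (-pi) = 0 \<and> V t x pi = 0)"

definition traveling ::
  "real \<Rightarrow> (real \<Rightarrow> real \<Rightarrow> real) \<Rightarrow> real \<Rightarrow> real \<Rightarrow> real \<Rightarrow> real" where
  "traveling c f = (\<lambda>t x y. f (x - c * t) y)"

definition traveling_wave_solution ::
  "real \<Rightarrow> real \<Rightarrow> (real \<Rightarrow> real \<Rightarrow> real) \<Rightarrow> (real \<Rightarrow> real \<Rightarrow> real) \<Rightarrow> bool" where
  "traveling_wave_solution L c u v \<longleftrightarrow> f_plane_solution L (traveling c u) (traveling c v)"

definition steady_solution ::
  "real \<Rightarrow> (real \<Rightarrow> real \<Rightarrow> real) \<Rightarrow> (real \<Rightarrow> real \<Rightarrow> real) \<Rightarrow> bool" where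
  "steady_solution L u v \<longleftrightarrow> f_plane_solution L (\<lambda>t. u) (\<lambda>t. v)"

text \<open>
  Being a shear flow is a condition on the second velocity component only; incompressibility
  then makes the first component independent of x.
\<close>

definition shear_flow :: "(real \<Rightarrow> real \<Rightarrow> real \<Rightarrow> real) \<Rightarrow> bool" where
  "shear_flow V \<longleftrightarrow> (\<forall>t x. \<forall>y\<in>{-pi..pi}. V t x y = 0)"

definition L0 :: real where
  "L0 = 4 * pi / sqrt 3"

definition u_kol :: "real \<Rightarrow> real \<Rightarrow> real" where
  "u_kol x y = sin y"

definition u_eps :: "real \<Rightarrow> real \<Rightarrow> real \<Rightarrow> real" where
  "u_eps e x y = sin y + e / 2 * sin (y / 2) * sin (sqrt 3 / 2 * x)"

definition v_eps :: "real \<Rightarrow> real \<Rightarrow> real \<Rightarrow> real" where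
  "v_eps e x y = sqrt 3 * e / 2 * cos (y / 2) * cos (sqrt 3 / 2 * x)"

end

theory Submission
  imports Defs
begin

text \<open>
  In the moving frame put \<open>w = u - c\<close>. Eliminating the pressure gives \<open>w \<Delta>v = v \<Delta>u\<close>. With
  \<open>g = \<Delta>u + u\<close> this reads \<open>v (g - c) = w (\<Delta>v + v)\<close>, and since \<open>sin\<close> is annihilated by \<open>\<Delta> + 1\<close>
  the smallness assumption yields \<open>\<bar>g\<bar> < \<delta> \<le> \<bar>c\<bar>\<close>. Hence \<open>v = w h\<close> with \<open>h\<close> continuous, even where
  \<open>w = 0\<close>. Now \<open>w\<^sup>2 \<nabla>h = w \<nabla>v - v \<nabla>w\<close> is divergence free and \<open>v = 0\<close> at the walls, so an energy
  estimate forces \<open>w \<nabla>v = v \<nabla>w\<close>. With incompressibility this is \<open>w v\<^sub>x + v v\<^sub>y = 0\<close>, and integrating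
  it against \<open>y\<close> gives \<open>\<integral> v\<^sup>2 = 0\<close>.

  For the explicit flows, the stream function is an eigenfunction of the Laplacian, which
  provides the pressure in closed form.
\<close>

section \<open>Calculus on the channel\<close>

abbreviation continuous_on_channel :: "(real \<Rightarrow> real \<Rightarrow> real) \<Rightarrow> bool" where
  "continuous_on_channel f \<equiv> continuous_on (UNIV \<times> {-pi..pi}) (\<lambda>(x, y). f x y)"

text \<open>Partial derivatives as relations to a supplied derivative function, constrained only on
  the channel. Closed formulas can then stand in for \<open>dx f\<close> and \<open>dy f\<close>,
  whose values beyond the walls carry no information.\<close>

definition has_dx :: "(real \<Rightarrow> real \<Rightarrow> real) \<Rightarrow> (real \<Rightarrow> real \<Rightarrow> real) \<Rightarrow> bool" where
  "has_dx f f' \<longleftrightarrow> (\<forall>x. \<forall>y\<in>{-pi..pi}. ((\<lambda>s. f s y) has_real_derivative f' x y) (at x))"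

definition has_dy :: "(real \<Rightarrow> real \<Rightarrow> real) \<Rightarrow> (real \<Rightarrow> real \<Rightarrow> real) \<Rightarrow> bool" where
  "has_dy f f' \<longleftrightarrow>
     (\<forall>x. \<forall>y\<in>{-pi..pi}. ((\<lambda>s. f x s) has_real_derivative f' x y) (at y within {-pi..pi}))"

lemma has_dxD:
  "has_dx f f' \<Longrightarrow> y \<in> {-pi..pi} \<Longrightarrow> ((\<lambda>s. f s y) has_real_derivative f' x y) (at x)"
  by (auto simp: has_dx_def)

lemma has_dyD:
  "has_dy f f' \<Longrightarrow> y \<in> {-pi..pi} \<Longrightarrow>
    ((\<lambda>s. f x s) has_real_derivative f' x y) (at y within {-pi..pi})"
  by (auto simp: has_dy_def)

lemma dx_eq: "has_dx f f' \<Longrightarrow> y \<in> {-pi..pi} \<Longrightarrow> dx f x y = f' x y"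
  unfolding dx_def by (rule DERIV_imp_deriv) (rule has_dxD)

lemma dy_eq: "has_dy f f' \<Longrightarrow> y \<in> {-pi..pi} \<Longrightarrow> dy f x y = f' x y"
  unfolding dy_def
  using has_dyD[of f f' y x]
  by (intro vector_derivative_within_closed_interval[of "-pi" pi])
     (auto simp: has_real_derivative_iff_has_vector_derivative)

lemma Ck_Suc_has_dx: "Ck (Suc k) f \<Longrightarrow> has_dx f (dx f)"
  unfolding has_dx_def Ck.simps has_partials_def dx_def
  using DERIV_deriv_iff_real_differentiable by blast

lemma Ck_Suc_has_dy: "Ck (Suc k) f \<Longrightarrow> has_dy f (dy f)"
  unfolding has_dy_def Ck.simps has_partials_def dy_def
    has_real_derivative_iff_has_vector_derivative
  using vector_derivative_works by blast

lemma Ck_continuous: "Ck k f \<Longrightarrow> continuous_on_channel f"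
  by (cases k) auto

lemma continuous_on_channel_iff:
  "continuous_on_channel f \<longleftrightarrow> continuous_on (UNIV \<times> {-pi..pi}) (\<lambda>p. f (fst p) (snd p))"
  by (simp add: case_prod_beta)

lemma continuous_on_channel_subset:
  assumes "continuous_on_channel f"
  shows "continuous_on (cbox (a, -pi) (b, pi)) (\<lambda>p. f (fst p) (snd p))"
  using assms unfolding case_prod_beta
  by (rule continuous_on_subset) (auto simp: cbox_Pair_eq)

lemma continuous_on_slice_x:
  assumes "continuous_on_channel f" "y \<in> {-pi..pi}"
  shows "continuous_on A (\<lambda>x. f x y)"
  using continuous_on_compose2[OF assms(1), of A "\<lambda>x. (x, y)"] assms(2)
  by (auto simp: continuous_on_Pair image_subset_iff)

lemma has_dx_periodic:
  assumes f: "has_dx f f'" and per: "periodic_x L f" and y: "y \<in> {-pi..pi}"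
  shows "f' (x + L) y = f' x y"
proof -
  have "((\<lambda>s. f (s + L) y) has_real_derivative f' (x + L) y) (at x)"
    using has_dxD[OF f y, of "x + L"] by (simp add: DERIV_shift)
  moreover have "(\<lambda>s. f (s + L) y) = (\<lambda>s. f s y)"
    using per y by (auto simp: periodic_x_def)
  ultimately show ?thesis
    using DERIV_unique[OF _ has_dxD[OF f y, of x]] by simp
qed

text \<open>Fubini reduces both terms to one dimension: \<open>D1\<close> integrates to 0 over a
  period in x because \<open>G1\<close> is periodic, and \<open>D2\<close> integrates to 0 from wall
  to wall because \<open>G2\<close> vanishes there. The free base point \<open>a\<close> lets the
  box contain any prescribed point.\<close>

lemma divergence_theorem_channel:
  assumes G1: "has_dx G1 D1" and G2: "has_dy G2 D2"
    and c1: "continuous_on_channel D1" and c2: "continuous_on_channel D2"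
    and per: "periodic_x L G1" and wall: "\<And>x. G2 x (-pi) = 0" "\<And>x. G2 x pi = 0"
    and L: "L > 0"
  shows "integral (cbox (a, -pi) (a + L, pi)) (\<lambda>p. D1 (fst p) (snd p) + D2 (fst p) (snd p)) = 0"
proof -
  have b1: "continuous_on (cbox (a, -pi) (a + L, pi)) (\<lambda>p. D1 (fst p) (snd p))"
    and b2: "continuous_on (cbox (a, -pi) (a + L, pi)) (\<lambda>p. D2 (fst p) (snd p))"
    using c1 c2 by (auto intro: continuous_on_channel_subset)
  have "integral (cbox a (a + L)) (\<lambda>x. D1 x y) = 0" if y: "y \<in> cbox (-pi) pi" for y
  proof -
    have "((\<lambda>x. D1 x y) has_integral G1 (a + L) y - G1 a y) {a..a + L}"
      using y L
      by (intro fundamental_theorem_of_calculus)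
         (auto intro!: has_field_derivative_at_within has_dxD[OF G1]
               simp: has_real_derivative_iff_has_vector_derivative[symmetric])
    then show ?thesis
      using per y by (auto simp: periodic_x_def integral_unique)
  qed
  then have "integral (cbox (-pi) pi) (\<lambda>y. integral (cbox a (a + L)) (\<lambda>x. D1 x y)) = 0"
    by (subst integral_cong[where g = "\<lambda>_. 0"]) auto
  moreover have "integral (cbox a (a + L)) (\<lambda>x. integral (cbox (-pi) pi) (D1 x))
      = integral (cbox (-pi) pi) (\<lambda>y. integral (cbox a (a + L)) (\<lambda>x. D1 x y))"
    using b1 by (intro integral_swap_continuous) (simp add: case_prod_beta)
  ultimately have i1: "integral (cbox (a, -pi) (a + L, pi)) (\<lambda>p. D1 (fst p) (snd p)) = 0"
    using integral_prod_continuous[OF b1] by simp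
  have "integral (cbox (-pi) pi) (D2 x) = 0" for x
  proof -
    have "((\<lambda>y. D2 x y) has_integral G2 x pi - G2 x (-pi)) {-pi..pi}"
      by (intro fundamental_theorem_of_calculus)
         (auto intro!: has_dyD[OF G2]
               simp: has_real_derivative_iff_has_vector_derivative[symmetric])
    then show ?thesis
      by (simp add: wall integral_unique)
  qed
  then have i2: "integral (cbox (a, -pi) (a + L, pi)) (\<lambda>p. D2 (fst p) (snd p)) = 0"
    using integral_prod_continuous[OF b2] by simp
  show ?thesis
    using i1 i2 by (subst integral_add) (auto intro: integrable_continuous b1 b2)
qed

lemma integral_zero_imp_zero:
  fixes a b :: real
  assumes c: "continuous_on (cbox (a, -pi) (b, pi)) f" and "a < b"
    and nn: "\<And>p. p \<in> cbox (a, -pi) (b, pi) \<Longrightarrow> 0 \<le> f p"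
    and z: "integral (cbox (a, -pi) (b, pi)) f = 0"
    and p: "p \<in> cbox (a, -pi) (b, pi :: real)"
  shows "f p = (0 :: real)"
proof (rule has_integral_0_cbox_imp_0[OF c _ _ _ p])
  show "(f has_integral 0) (cbox (a, -pi) (b, pi))"
    using integrable_integral[OF integrable_continuous[OF c]] z by simp
  show "box (a, -pi) (b, pi) \<noteq> {}"
    using \<open>a < b\<close> by (auto simp: box_ne_empty Basis_prod_def)
qed (use nn box_subset_cbox in blast)

text \<open>An asymmetric Schwarz theorem: the x-derivative of \<open>fy\<close> is part of the
  conclusion, as is required for a pressure that is only of class C^1. Write
  \<open>f z s - f (x - 1) s\<close> as an integral of \<open>fx\<close>, differentiate under the
  integral sign in \<open>s\<close>, then apply the fundamental theorem in \<open>z\<close>.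
  Starting at \<open>x - 1\<close> keeps \<open>x\<close> an interior point.\<close>

lemma mixed_partials_eq:
  assumes f: "has_dx f fx" "has_dy f fy" and fxy: "has_dy fx fxy"
    and c: "continuous_on_channel fx" "continuous_on_channel fxy"
  shows "has_dx fy fxy"
  unfolding has_dx_def
proof (intro allI ballI)
  fix x y :: real assume y: "y \<in> {-pi..pi}"
  have ftc: "integral {x - 1..z} (\<lambda>t. fx t s) = f z s - f (x - 1) s"
    if "z \<ge> x - 1" "s \<in> {-pi..pi}" for z s
    using that
    by (intro integral_unique fundamental_theorem_of_calculus)
       (auto intro!: has_field_derivative_at_within has_dxD[OF f(1)]
             simp: has_real_derivative_iff_has_vector_derivative[symmetric])
  have eq: "fy z y - fy (x - 1) y = integral {x - 1..z} (\<lambda>t. fxy t y)" if z: "z \<ge> x - 1" for z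
  proof -
    have "((\<lambda>s. integral (cbox (x - 1) z) (\<lambda>t. fx t s)) has_field_derivative
        integral (cbox (x - 1) z) (\<lambda>t. fxy t y)) (at y within {-pi..pi})"
    proof (rule leibniz_rule_field_derivative)
      show "continuous_on ({-pi..pi} \<times> cbox (x - 1) z) (\<lambda>(s, t). fxy t s)"
        using continuous_on_compose2[OF c(2), of "{-pi..pi} \<times> cbox (x - 1) z" "\<lambda>p. (snd p, fst p)"]
        by (simp add: case_prod_beta image_subset_iff continuous_intros)
    qed (use y in \<open>auto intro!: has_dyD[OF fxy] integrable_continuous_real continuous_on_slice_x[OF c(1)]\<close>)
    then have "((\<lambda>s. integral {x - 1..z} (\<lambda>t. fx t s)) has_field_derivative
        integral {x - 1..z} (\<lambda>t. fxy t y)) (at y within {-pi..pi})"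
      by simp
    then have "((\<lambda>s. f z s - f (x - 1) s) has_field_derivative
        integral {x - 1..z} (\<lambda>t. fxy t y)) (at y within {-pi..pi})"
      by (rule has_field_derivative_transform_within[where d = 1]) (use y z ftc in auto)
    moreover have "((\<lambda>s. f z s - f (x - 1) s) has_field_derivative (fy z y - fy (x - 1) y))
        (at y within {-pi..pi})"
      by (intro derivative_intros has_dyD[OF f(2)] y)
    moreover have "-pi < pi" by simp
    ultimately show ?thesis
      using y unfolding has_real_derivative_iff_has_vector_derivative
      by (metis vector_derivative_within_closed_interval)
  qed
  have "((\<lambda>z. integral {x - 1..z} (\<lambda>t. fxy t y)) has_real_derivative fxy x y)
      (at x within {x - 1..x + 1})"
    by (rule integral_has_real_derivative) (auto intro!: continuous_on_slice_x[OF c(2) y])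
  then have "((\<lambda>z. fy (x - 1) y + integral {x - 1..z} (\<lambda>t. fxy t y)) has_real_derivative fxy x y)
      (at x within {x - 1..x + 1})"
    by (auto intro!: derivative_eq_intros)
  then have "((\<lambda>z. fy z y) has_real_derivative fxy x y) (at x within {x - 1..x + 1})"
    by (rule has_field_derivative_transform_within[where d = 1]) (auto simp flip: eq)
  then show "((\<lambda>z. fy z y) has_real_derivative fxy x y) (at x)"
    using at_within_Icc_at[of "x - 1" x "x + 1"] by simp
qed

section \<open>Rigidity of traveling waves\<close>

text \<open>
  The flux \<open>F = w \<nabla>v - v \<nabla>w = w\<^sup>2 \<nabla>(v/w)\<close> is divergence free. Testing it against \<open>v/w\<close> would
  give \<open>\<integral> \<bar>F\<bar>\<^sup>2/w\<^sup>2 = 0\<close>; since \<open>w\<close> may vanish, the test function is \<open>T = v w/(w\<^sup>2 + e\<^sup>2)\<close>, and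
  the error term \<open>R\<close> disappears as \<open>e\<close> tends to 0 because \<open>h = v/w\<close> stays bounded.
\<close>

lemma ratio_rigidity:
  fixes v w h :: "real \<Rightarrow> real \<Rightarrow> real"
  assumes w: "has_dx w wx" "has_dy w wy" "has_dx wx wxx" "has_dy wy wyy"
    and v: "has_dx v vx" "has_dy v vy" "has_dx vx vxx" "has_dy vy vyy"
    and cw: "continuous_on_channel w" "continuous_on_channel wx" "continuous_on_channel wy"
            "continuous_on_channel wxx" "continuous_on_channel wyy"
    and cv: "continuous_on_channel v" "continuous_on_channel vx" "continuous_on_channel vy"
            "continuous_on_channel vxx" "continuous_on_channel vyy"
    and ch: "continuous_on_channel h"
    and vwh: "\<And>x y. y \<in> {-pi..pi} \<Longrightarrow> v x y = w x y * h x y"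
    and elliptic: "\<And>x y. y \<in> {-pi..pi} \<Longrightarrow>
        w x y * (vxx x y + vyy x y) = v x y * (wxx x y + wyy x y)"
    and per: "periodic_x L w" "periodic_x L v"
    and wall: "\<And>x. v x (-pi) = 0" "\<And>x. v x pi = 0"
    and L: "L > 0" and y: "y \<in> {-pi..pi}"
  shows "w x y * vx x y = v x y * wx x y" "w x y * vy x y = v x y * wy x y"
proof -
  define F1 where "F1 = (\<lambda>x y. w x y * vx x y - v x y * wx x y)"
  define F2 where "F2 = (\<lambda>x y. w x y * vy x y - v x y * wy x y)"
  \<comment> \<open>With \<open>v = w h\<close>, both F and the gradient of the product
    \<open>w v\<close> carry a factor \<open>w\<close>; \<open>K\<close> is their inner product
    divided by \<open>w\<^sup>2\<close>. It is continuous and independent of \<open>e\<close>, hence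
    an integrable majorant for \<open>R\<close>.\<close>
  define K where "K = (\<lambda>x y. (vx x y - h x y * wx x y) * (vx x y + h x y * wx x y)
      + (vy x y - h x y * wy x y) * (vy x y + h x y * wy x y))"
  define J where "J = (\<lambda>e x y. (w x y)\<^sup>2 * ((F1 x y)\<^sup>2 + (F2 x y)\<^sup>2) / ((w x y)\<^sup>2 + e\<^sup>2)\<^sup>2)"
  define R where "R = (\<lambda>e x y. e\<^sup>2 * (w x y)\<^sup>2 * K x y / ((w x y)\<^sup>2 + e\<^sup>2)\<^sup>2)"
  define B where "B = cbox (x, -pi) (x + L, pi)"
  note c = cw[THEN continuous_on_channel_subset] cv[THEN continuous_on_channel_subset]
    ch[THEN continuous_on_channel_subset]
  have pos: "(w x y)\<^sup>2 + e\<^sup>2 > 0" if "e > 0" for e x y :: real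
    using that by (simp add: add_nonneg_pos)
  have cJ: "continuous_on B (\<lambda>p. J e (fst p) (snd p))" if "e > 0" for e
    unfolding J_def F1_def F2_def B_def
    using that by (intro continuous_intros c) (simp add: sum_power2_eq_zero_iff)
  have cR: "continuous_on B (\<lambda>p. R e (fst p) (snd p))" if "e > 0" for e
    unfolding R_def K_def B_def
    using that by (intro continuous_intros c) (simp add: sum_power2_eq_zero_iff)
  have int: "integral B (\<lambda>p. J e (fst p) (snd p)) + integral B (\<lambda>p. R e (fst p) (snd p)) = 0"
    if e: "e > 0" for e
  proof -
    define D where "D = (\<lambda>x y. (w x y)\<^sup>2 + e\<^sup>2)"
    define T where "T = (\<lambda>x y. v x y * w x y / D x y)"
    define Tx where "Tx = (\<lambda>x y. ((vx x y * w x y + v x y * wx x y) * D x y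
        - v x y * w x y * (2 * w x y * wx x y)) / (D x y)\<^sup>2)"
    define Ty where "Ty = (\<lambda>x y. ((vy x y * w x y + v x y * wy x y) * D x y
        - v x y * w x y * (2 * w x y * wy x y)) / (D x y)\<^sup>2)"
    \<comment> \<open>In the x-derivative of \<open>F1\<close> the terms \<open>wx vx\<close>
      cancel, leaving \<open>w vxx - v wxx\<close>; likewise for \<open>F2\<close> in y. By
      \<open>elliptic\<close> these two remainders add up to 0.\<close>
    define D1 where "D1 = (\<lambda>x y. Tx x y * F1 x y + T x y * (w x y * vxx x y - v x y * wxx x y))"
    define D2 where "D2 = (\<lambda>x y. Ty x y * F2 x y + T x y * (w x y * vyy x y - v x y * wyy x y))"
    have D: "D x y \<noteq> 0" for x y
      using e by (simp add: D_def sum_power2_eq_zero_iff)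
    have 1: "has_dx (\<lambda>x y. T x y * F1 x y) D1"
      unfolding has_dx_def
    proof (intro allI ballI)
      fix x y :: real assume y: "y \<in> {-pi..pi}"
      show "((\<lambda>s. T s y * F1 s y) has_real_derivative D1 x y) (at x)"
      proof -
        have "((\<lambda>s. v s y * w s y) has_real_derivative vx x y * w x y + v x y * wx x y) (at x)"
          by (auto intro!: derivative_eq_intros has_dxD[OF w(1) y] has_dxD[OF v(1) y])
        moreover have "((\<lambda>s. D s y) has_real_derivative 2 * w x y * wx x y) (at x)"
          unfolding D_def by (auto intro!: derivative_eq_intros has_dxD[OF w(1) y])
        ultimately have "((\<lambda>s. T s y) has_real_derivative Tx x y) (at x)"
          unfolding T_def Tx_def power2_eq_square[of "D x y"] by (rule DERIV_divide) (rule D)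
        moreover have "((\<lambda>s. F1 s y) has_real_derivative w x y * vxx x y - v x y * wxx x y)
            (at x)"
          unfolding F1_def by (auto intro!: derivative_eq_intros has_dxD[OF w(1) y] has_dxD[OF w(3) y]
              has_dxD[OF v(1) y] has_dxD[OF v(3) y])
        ultimately show ?thesis
          unfolding D1_def by (rule DERIV_mult[THEN DERIV_cong]) (simp add: mult.commute)
      qed
    qed
    have 2: "has_dy (\<lambda>x y. T x y * F2 x y) D2"
      unfolding has_dy_def
    proof (intro allI ballI)
      fix x y :: real assume y: "y \<in> {-pi..pi}"
      show "((\<lambda>s. T x s * F2 x s) has_real_derivative D2 x y) (at y within {-pi..pi})"
      proof -
        have "((\<lambda>s. v x s * w x s) has_real_derivative vy x y * w x y + v x y * wy x y)
            (at y within {-pi..pi})"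
          by (auto intro!: derivative_eq_intros has_dyD[OF w(2) y] has_dyD[OF v(2) y])
        moreover have "((\<lambda>s. D x s) has_real_derivative 2 * w x y * wy x y)
            (at y within {-pi..pi})"
          unfolding D_def by (auto intro!: derivative_eq_intros has_dyD[OF w(2) y])
        ultimately have "((\<lambda>s. T x s) has_real_derivative Ty x y) (at y within {-pi..pi})"
          unfolding T_def Ty_def power2_eq_square[of "D x y"] by (rule DERIV_divide) (rule D)
        moreover have "((\<lambda>s. F2 x s) has_real_derivative w x y * vyy x y - v x y * wyy x y)
            (at y within {-pi..pi})"
          unfolding F2_def by (auto intro!: derivative_eq_intros has_dyD[OF w(2) y] has_dyD[OF w(4) y]
              has_dyD[OF v(2) y] has_dyD[OF v(4) y])
        ultimately show ?thesis
          unfolding D2_def by (rule DERIV_mult[THEN DERIV_cong]) (simp add: mult.commute)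
      qed
    qed
    have split: "D1 x y + D2 x y = J e x y + R e x y" if y: "y \<in> {-pi..pi}" for x y
    proof -
      have "D1 x y + D2 x y = Tx x y * F1 x y + Ty x y * F2 x y
          + T x y * (w x y * (vxx x y + vyy x y) - v x y * (wxx x y + wyy x y))"
        unfolding D1_def D2_def by (simp add: algebra_simps)
      also have "\<dots> = Tx x y * F1 x y + Ty x y * F2 x y"
        by (simp add: elliptic[OF y])
      \<comment> \<open>The numerator of the gradient of \<open>T\<close> regroups as
        \<open>w\<^sup>2\<close> F plus \<open>e\<^sup>2\<close> times the gradient of
        \<open>w v\<close>. The first part produces \<open>J\<close>, the second
        \<open>R\<close>.\<close>
      also have "\<dots> = (((w x y)\<^sup>2 * F1 x y + e\<^sup>2 * (vx x y * w x y + v x y * wx x y)) * F1 x y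
          + ((w x y)\<^sup>2 * F2 x y + e\<^sup>2 * (vy x y * w x y + v x y * wy x y)) * F2 x y) / (D x y)\<^sup>2"
        unfolding Tx_def Ty_def F1_def F2_def add_divide_distrib times_divide_eq_left
        by (intro arg_cong2[where f = "(+)"] arg_cong2[where f = "(/)"] refl)
           (simp_all add: D_def power2_eq_square algebra_simps)
      also have "\<dots> = J e x y + R e x y"
        unfolding J_def R_def K_def F1_def F2_def vwh[OF y] D_def add_divide_distrib[symmetric]
        by (intro arg_cong2[where f = "(/)"] refl) (simp add: power2_eq_square algebra_simps)
      finally show ?thesis .
    qed
    have c1: "continuous_on_channel D1" and c2: "continuous_on_channel D2"
      unfolding D1_def D2_def Tx_def Ty_def T_def F1_def F2_def case_prod_beta
      using D unfolding D_def
      by (intro continuous_intros cw[THEN continuous_on_channel_iff[THEN iffD1]]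
          cv[THEN continuous_on_channel_iff[THEN iffD1]]; simp)+
    have "integral B (\<lambda>p. D1 (fst p) (snd p) + D2 (fst p) (snd p)) = 0"
      unfolding B_def
    proof (rule divergence_theorem_channel[OF 1 2 c1 c2 _ _ _ L])
      show "periodic_x L (\<lambda>x y. T x y * F1 x y)"
        using per has_dx_periodic[OF w(1) per(1)] has_dx_periodic[OF v(1) per(2)]
        by (simp add: periodic_x_def T_def F1_def D_def)
    qed (simp_all add: T_def wall)
    also have "integral B (\<lambda>p. D1 (fst p) (snd p) + D2 (fst p) (snd p))
        = integral B (\<lambda>p. J e (fst p) (snd p) + R e (fst p) (snd p))"
      by (rule integral_cong) (auto simp: B_def cbox_Pair_eq split)
    finally show ?thesis
      using cJ[OF e] cR[OF e]
      by (subst (asm) integral_add) (auto simp: B_def intro: integrable_continuous)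
  qed
  define E where "E = (\<lambda>n. 1 / real (Suc n))"
  have E: "E n > 0" "E n \<le> 1" for n
    by (auto simp: E_def field_simps)
  have E0: "E \<longlonglongrightarrow> 0"
    unfolding E_def by (rule LIMSEQ_Suc) (rule lim_1_over_n)
  have "(\<lambda>n. integral B (\<lambda>p. R (E n) (fst p) (snd p))) \<longlonglongrightarrow> integral B (\<lambda>p. 0)"
  proof (rule dominated_convergence)
    show "(\<lambda>p. R (E n) (fst p) (snd p)) integrable_on B" for n
      using cR[OF E(1)] by (auto simp: B_def intro: integrable_continuous)
    show "(\<lambda>p. \<bar>K (fst p) (snd p)\<bar>) integrable_on B"
      unfolding K_def B_def by (intro integrable_continuous continuous_intros c)
    fix p
    show "norm (R (E n) (fst p) (snd p)) \<le> \<bar>K (fst p) (snd p)\<bar>" for n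
    proof -
      let ?a = "(w (fst p) (snd p))\<^sup>2" and ?b = "(E n)\<^sup>2" and ?K = "\<bar>K (fst p) (snd p)\<bar>"
      \<comment> \<open>The elementary bound ab \<le> (a + b)^2 for nonnegative a, b gives a
        majorant uniform in \<open>n\<close>, including the points where \<open>w\<close> is
        small.\<close>
      have "?b * ?a \<le> (?a + ?b)\<^sup>2"
        by (simp add: power2_sum add_nonneg_nonneg algebra_simps)
      then have "?b * ?a * ?K \<le> ?K * (?a + ?b)\<^sup>2"
        by (metis abs_ge_zero mult.commute mult_left_mono)
      then have "?b * ?a * ?K / (?a + ?b)\<^sup>2 \<le> ?K"
        using pos[OF E(1), of "fst p" "snd p" n] by (intro mult_imp_div_pos_le) auto
      then show ?thesis
        by (simp add: R_def abs_mult)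
    qed
    \<comment> \<open>Where \<open>w = 0\<close>, the factor \<open>w\<^sup>2\<close> makes
      \<open>R\<close> vanish identically; elsewhere the denominator stays away from 0.\<close>
    show "(\<lambda>n. R (E n) (fst p) (snd p)) \<longlonglongrightarrow> 0"
    proof (cases "w (fst p) (snd p) = 0")
      case False
      have "(\<lambda>n. R (E n) (fst p) (snd p)) \<longlonglongrightarrow>
          0\<^sup>2 * (w (fst p) (snd p))\<^sup>2 * K (fst p) (snd p) / ((w (fst p) (snd p))\<^sup>2 + 0\<^sup>2)\<^sup>2"
        unfolding R_def using False by (intro tendsto_intros E0) auto
      then show ?thesis by simp
    qed (simp add: R_def)
  qed
  then have "(\<lambda>n. - integral B (\<lambda>p. R (E n) (fst p) (snd p))) \<longlonglongrightarrow> - integral B (\<lambda>p. 0)"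
    by (rule tendsto_minus)
  moreover have "- integral B (\<lambda>p. R (E n) (fst p) (snd p))
      = integral B (\<lambda>p. J (E n) (fst p) (snd p))" for n
    using int[OF E(1), of n] by linarith
  ultimately have "(\<lambda>n. integral B (\<lambda>p. J (E n) (fst p) (snd p))) \<longlonglongrightarrow> 0"
    by simp
  \<comment> \<open>\<open>J e\<close> decreases in \<open>e\<close> and \<open>E n\<close> is at
    most 1, so the fixed integrand \<open>J 1\<close> lies below every term of a sequence whose
    integrals tend to 0.\<close>
  moreover have "integral B (\<lambda>p. J 1 (fst p) (snd p))
      \<le> integral B (\<lambda>p. J (E n) (fst p) (snd p))" for n
  proof (rule integral_le)
    show "J 1 (fst p) (snd p) \<le> J (E n) (fst p) (snd p)" for p
      unfolding J_def using E[of n] pos[OF E(1), of "fst p" "snd p" n] pos[of 1 "fst p" "snd p"]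
      by (intro divide_left_mono power_mono add_left_mono mult_pos_pos)
         (auto intro!: add_nonneg_nonneg zero_less_power add_nonneg_pos)
  qed (use cJ E in \<open>auto simp: B_def intro: integrable_continuous\<close>)
  ultimately have "integral B (\<lambda>p. J 1 (fst p) (snd p)) \<le> 0"
    by (intro LIMSEQ_le_const) auto
  moreover have J0: "0 \<le> J 1 x y" for x y
    by (simp add: J_def)
  ultimately have "integral B (\<lambda>p. J 1 (fst p) (snd p)) = 0"
    using cJ[of 1]
    by (intro antisym integral_nonneg) (auto simp: B_def intro: integrable_continuous)
  then have "J 1 x y = 0"
    using integral_zero_imp_zero[of x "x + L" "\<lambda>p. J 1 (fst p) (snd p)" "(x, y)"]
      cJ[of 1] J0 L y by (simp add: B_def)
  then have "w x y = 0 \<or> F1 x y = 0 \<and> F2 x y = 0"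
    using pos[of 1 x y] by (auto simp: J_def)
  \<comment> \<open>At a zero of \<open>w\<close> also \<open>v = w h = 0\<close>, so F vanishes
    there directly.\<close>
  then have "F1 x y = 0" "F2 x y = 0"
    using vwh[OF y, of x] by (auto simp: F1_def F2_def)
  then show "w x y * vx x y = v x y * wx x y" "w x y * vy x y = v x y * wy x y"
    by (auto simp: F1_def F2_def)
qed

text \<open>Heuristically, \<open>straight\<close> says that a particle moving with the field
  \<open>(w, v)\<close> keeps its vertical speed \<open>v\<close>, and a nonzero constant speed
  would carry it out through a wall. The proof replaces particle paths by an integral
  identity.\<close>

lemma straight_streamlines_imp_shear:
  fixes v w :: "real \<Rightarrow> real \<Rightarrow> real"
  assumes w: "has_dx w wx" and v: "has_dx v vx" "has_dy v vy"
    and c: "continuous_on_channel w" "continuous_on_channel wx" "continuous_on_channel v"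
      "continuous_on_channel vx" "continuous_on_channel vy"
    and div: "\<And>x y. y \<in> {-pi..pi} \<Longrightarrow> wx x y + vy x y = 0"
    and straight: "\<And>x y. y \<in> {-pi..pi} \<Longrightarrow> w x y * vx x y + v x y * vy x y = 0"
    and per: "periodic_x L w" "periodic_x L v"
    and wall: "\<And>x. v x (-pi) = 0" "\<And>x. v x pi = 0"
    and L: "L > 0" and y: "y \<in> {-pi..pi}"
  shows "v x y = 0"
proof -
  \<comment> \<open>\<open>\<partial>\<^sub>x (y w v) + \<partial>\<^sub>y (y v\<^sup>2) = v\<^sup>2\<close>: the weight \<open>y\<close> turns the conservation law into an energy.\<close>
  define D1 where "D1 = (\<lambda>x y. y * (wx x y * v x y + w x y * vx x y))"
  define D2 where "D2 = (\<lambda>x y. (v x y)\<^sup>2 + y * (2 * v x y * vy x y))"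
  have eq: "D1 x y + D2 x y = (v x y)\<^sup>2" if "y \<in> {-pi..pi}" for x y
  proof -
    have "D1 x y + D2 x y = (v x y)\<^sup>2 + y * (v x y * (wx x y + vy x y))
        + y * (w x y * vx x y + v x y * vy x y)"
      by (simp add: D1_def D2_def algebra_simps)
    then show ?thesis using div[OF that] straight[OF that] by simp
  qed
  have "integral (cbox (x, -pi) (x + L, pi)) (\<lambda>p. D1 (fst p) (snd p) + D2 (fst p) (snd p)) = 0"
  proof (rule divergence_theorem_channel[OF _ _ _ _ _ _ _ L])
    show "has_dx (\<lambda>x y. y * (w x y * v x y)) D1"
      unfolding has_dx_def D1_def
      by (auto intro!: derivative_eq_intros has_dxD[OF w] has_dxD[OF v(1)])
    show "has_dy (\<lambda>x y. y * (v x y)\<^sup>2) D2"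
      unfolding has_dy_def D2_def
      by (auto intro!: derivative_eq_intros has_dyD[OF v(2)] simp: power2_eq_square)
    show "continuous_on_channel D1" "continuous_on_channel D2"
      unfolding D1_def D2_def case_prod_beta
      by (intro continuous_intros c[THEN continuous_on_channel_iff[THEN iffD1]])+
  qed (use per wall in \<open>auto simp: periodic_x_def\<close>)
  also have "integral (cbox (x, -pi) (x + L, pi)) (\<lambda>p. D1 (fst p) (snd p) + D2 (fst p) (snd p))
      = integral (cbox (x, -pi) (x + L, pi)) (\<lambda>p. (v (fst p) (snd p))\<^sup>2)"
    by (rule integral_cong) (auto simp: cbox_Pair_eq eq)
  finally have "(v (fst (x, y)) (snd (x, y)))\<^sup>2 = 0"
    using y L c(3)
    by (intro integral_zero_imp_zero[of x "x + L" "\<lambda>p. (v (fst p) (snd p))\<^sup>2"])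
       (auto intro!: continuous_intros continuous_on_channel_subset[of v])
  then show ?thesis by simp
qed

section \<open>Agreement on the channel and pointwise bounds from the norms\<close>

lemma has_dx_cong:
  assumes "has_dx f f'" and "\<And>x y. y \<in> {-pi..pi} \<Longrightarrow> f x y = g x y"
    and "\<And>x y. y \<in> {-pi..pi} \<Longrightarrow> f' x y = g' x y"
  shows "has_dx g g'"
  unfolding has_dx_def
proof (intro allI ballI)
  fix x y :: real assume y: "y \<in> {-pi..pi}"
  then show "((\<lambda>s. g s y) has_real_derivative g' x y) (at x)"
    using has_dxD[OF assms(1) y, of x] assms(2,3)[OF y] by simp
qed

lemma has_dy_cong:
  assumes "has_dy f f'" and "\<And>x y. y \<in> {-pi..pi} \<Longrightarrow> f x y = g x y"
    and "\<And>x y. y \<in> {-pi..pi} \<Longrightarrow> f' x y = g' x y"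
  shows "has_dy g g'"
  unfolding has_dy_def
proof (intro allI ballI)
  fix x y :: real assume y: "y \<in> {-pi..pi}"
  then show "((\<lambda>s. g x s) has_real_derivative g' x y) (at y within {-pi..pi})"
    using has_dyD[OF assms(1) y, of x] assms(2)[of _ x] assms(3)[OF y, of x]
    by (rule_tac has_field_derivative_transform_within[where d = 1 and f = "\<lambda>s. f x s"]) auto
qed

lemma le_sup_norm: "y \<in> {-pi..pi} \<Longrightarrow> ennreal \<bar>f x y\<bar> \<le> sup_norm f"
  unfolding sup_norm_def by (rule SUP_upper2[of "(x, y)"]) auto

lemma sup_norm_le:
  "(\<And>x y. y \<in> {-pi..pi} \<Longrightarrow> \<bar>f x y\<bar> \<le> B) \<Longrightarrow> sup_norm f \<le> ennreal B"
  unfolding sup_norm_def by (rule SUP_least) (auto intro: ennreal_leI)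

text \<open>The three summands kept are exactly those that make up \<Delta>f + f. Since the norm is
  a sum of sup norms, this bound costs no constant, which preserves the sharp threshold
  \<delta>.\<close>

lemma Ck_norm_2_ge:
  assumes y: "y \<in> {-pi..pi}"
  shows "ennreal (\<bar>f x y\<bar> + \<bar>dx (dx f) x y\<bar> + \<bar>dy (dy f) x y\<bar>) \<le> Ck_norm 2 f"
proof -
  let ?g = "\<lambda>(i, j). sup_norm ((dx ^^ i) ((dy ^^ j) f))"
  have fin: "finite {(i, j). i + j \<le> (2 :: nat)}"
    by (rule finite_subset[of _ "{..2} \<times> {..2}"]) auto
  have "ennreal (\<bar>f x y\<bar> + \<bar>dx (dx f) x y\<bar> + \<bar>dy (dy f) x y\<bar>)
      = ennreal \<bar>f x y\<bar> + ennreal \<bar>dx (dx f) x y\<bar> + ennreal \<bar>dy (dy f) x y\<bar>"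
    by (simp add: ennreal_plus)
  also have "\<dots> \<le> sup_norm f + sup_norm (dx (dx f)) + sup_norm (dy (dy f))"
    by (intro add_mono le_sup_norm y)
  also have "\<dots> = sum ?g {(0, 0), (2, 0), (0, 2)}"
    by (simp add: numeral_2_eq_2 add.assoc)
  also have "\<dots> \<le> sum ?g {(i, j). i + j \<le> 2}"
    by (rule sum_mono2[OF fin]) auto
  finally show ?thesis by (simp add: Ck_norm_def)
qed

section \<open>The vorticity equation of a traveling wave\<close>

lemma traveling_wave_solutionD:
  assumes "traveling_wave_solution L c u v"
  shows "periodic_x L u" "periodic_x L v" "v x (-pi) = 0" "v x pi = 0"
    and "y \<in> {-pi..pi} \<Longrightarrow> dx u x y + dy v x y = 0"
    and "\<exists>P. Ck 1 P \<and> (\<forall>x. \<forall>y\<in>{-pi..pi}.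
      deriv (\<lambda>s. u (x - c * s) y) 0 + u x y * dx u x y + v x y * dy u x y = - dx P x y \<and>
      deriv (\<lambda>s. v (x - c * s) y) 0 + u x y * dx v x y + v x y * dy v x y = - dy P x y)"
proof -
  \<comment> \<open>The equations are read off at time 0, where the wave coincides with its profile.
    The pressure is not assumed to travel with the wave; its snapshot \<open>P 0\<close> serves as
    witness.\<close>
  have t0: "traveling c f 0 = f" for f by (simp add: traveling_def)
  have tv: "traveling c f t x y = f (x - c * t) y" for f t x y by (simp add: traveling_def)
  note sol = assms[unfolded traveling_wave_solution_def f_plane_solution_def]
  show "periodic_x L u" "periodic_x L v" using sol t0 by metis+
  show "v x (-pi) = 0" "v x pi = 0" using sol t0 by metis+
  show "dx u x y + dy v x y = 0" if "y \<in> {-pi..pi}" using sol t0 that by metis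
  obtain P where P: "\<And>t. Ck 1 (P t)" and mom: "\<And>t x y. y \<in> {-pi..pi} \<Longrightarrow>
    deriv (\<lambda>s. traveling c u s x y) t + traveling c u t x y * dx (traveling c u t) x y
      + traveling c v t x y * dy (traveling c u t) x y = - dx (P t) x y \<and>
    deriv (\<lambda>s. traveling c v s x y) t + traveling c u t x y * dx (traveling c v t) x y
      + traveling c v t x y * dy (traveling c v t) x y = - dy (P t) x y"
    using sol by metis
  show "\<exists>P. Ck 1 P \<and> (\<forall>x. \<forall>y\<in>{-pi..pi}.
      deriv (\<lambda>s. u (x - c * s) y) 0 + u x y * dx u x y + v x y * dy u x y = - dx P x y \<and>
      deriv (\<lambda>s. v (x - c * s) y) 0 + u x y * dx v x y + v x y * dy v x y = - dy P x y)"
    using P[of 0] mom[where t = 0] unfolding t0 unfolding tv by (intro exI[of _ "P 0"]) blast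
qed

lemma traveling_wave_vorticity:
  assumes sol: "traveling_wave_solution L c u v" and u: "Ck 2 u" and v: "Ck 2 v"
    and y: "y \<in> {-pi..pi}"
  shows "(u x y - c) * (dx (dx v) x y + dy (dy v) x y) = v x y * (dx (dx u) x y + dy (dy u) x y)"
proof -
  note C2 = u[unfolded numeral_2_eq_2] v[unfolded numeral_2_eq_2]
  have C1: "Ck 1 (dx u)" "Ck 1 (dy u)" "Ck 1 (dx v)" "Ck 1 (dy v)"
    using C2 by simp_all
  note d = C2[THEN Ck_Suc_has_dx] C2[THEN Ck_Suc_has_dy]
    C1[unfolded One_nat_def, THEN Ck_Suc_has_dx] C1[unfolded One_nat_def, THEN Ck_Suc_has_dy]
  note div = traveling_wave_solutionD(5)[OF sol]
  obtain P where P: "Ck 1 P" and mom: "\<And>x y. y \<in> {-pi..pi} \<Longrightarrow>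
      deriv (\<lambda>s. u (x - c * s) y) 0 + u x y * dx u x y + v x y * dy u x y = - dx P x y \<and>
      deriv (\<lambda>s. v (x - c * s) y) 0 + u x y * dx v x y + v x y * dy v x y = - dy P x y"
    using traveling_wave_solutionD(6)[OF sol] by blast
  \<comment> \<open>The time derivative is -c times the x-derivative, so the transport velocity
    \<open>u\<close> becomes \<open>u - c\<close>.\<close>
  have time: "deriv (\<lambda>s. f (x - c * s) y) 0 = - c * dx f x y"
    if f: "has_dx f (dx f)" and y: "y \<in> {-pi..pi}" for f x y
  proof (rule DERIV_imp_deriv)
    have "((\<lambda>s. f (x - c * s) y) has_real_derivative dx f (x - c * 0) y * (- c)) (at 0)"
      by (rule DERIV_chain2[where f = "\<lambda>s. f s y"])
         (auto intro!: has_dxD[OF f y] derivative_eq_intros)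
    then show "((\<lambda>s. f (x - c * s) y) has_real_derivative - c * dx f x y) (at 0)"
      by (simp add: mult.commute)
  qed
  let ?w = "\<lambda>x y. u x y - c"
  let ?A = "\<lambda>x y. - (?w x y * dx u x y + v x y * dy u x y)"
  let ?B = "\<lambda>x y. - (?w x y * dx v x y + v x y * dy v x y)"
  have PA: "has_dx P ?A" and PB: "has_dy P ?B"
  proof -
    show "has_dx P ?A"
      using Ck_Suc_has_dx[of 0 P] P
      by (rule_tac has_dx_cong[of P "dx P"])
         (use mom time[OF d(1)] in \<open>auto simp: algebra_simps\<close>)
    show "has_dy P ?B"
      using Ck_Suc_has_dy[of 0 P] P
      by (rule_tac has_dy_cong[of P "dy P"])
         (use mom time[OF d(2)] in \<open>auto simp: algebra_simps\<close>)
  qed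
  \<comment> \<open>Incompressibility trades the mixed derivatives of \<open>u\<close> and
    \<open>v\<close> for pure ones: the y-derivative of \<open>dx u\<close> is
    \<open>- dy (dy v)\<close>, and the x-derivative of \<open>dy v\<close> is
    \<open>- dx (dx u)\<close>. Only Laplacians then remain in the curl.\<close>
  have div': "- dy v x y = dx u x y" "- dx u x y = dy v x y" if "y \<in> {-pi..pi}" for x y
    using div[OF that, of x] by linarith+
  have "has_dy (\<lambda>x y. - dy v x y) (\<lambda>x y. - dy (dy v) x y)"
    unfolding has_dy_def by (auto intro!: derivative_intros has_dyD[OF d(12)])
  then have ux_y: "has_dy (dx u) (\<lambda>x y. - dy (dy v) x y)"
    by (rule has_dy_cong) (simp_all add: div')
  have "has_dx (\<lambda>x y. - dx u x y) (\<lambda>x y. - dx (dx u) x y)"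
    unfolding has_dx_def by (auto intro!: derivative_intros has_dxD[OF d(5)])
  then have vy_x: "has_dx (dy v) (\<lambda>x y. - dx (dx u) x y)"
    by (rule has_dx_cong) (simp_all add: div')
  define Ay where "Ay = (\<lambda>x y. ?w x y * dy (dy v) x y - v x y * dy (dy u) x y
      - dy u x y * (dx u x y + dy v x y))"
  define Bx where "Bx = (\<lambda>x y. v x y * dx (dx u) x y - ?w x y * dx (dx v) x y
      - dx v x y * (dx u x y + dy v x y))"
  have A: "has_dy ?A Ay"
    unfolding has_dy_def Ay_def
    by (auto intro!: derivative_eq_intros d(3,4,10)[THEN has_dyD] has_dyD[OF ux_y]
        simp: algebra_simps)
  have B: "has_dx ?B Bx"
    unfolding has_dx_def Bx_def
    by (auto intro!: derivative_eq_intros d(1,2,7)[THEN has_dxD] has_dxD[OF vy_x]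
        simp: algebra_simps)
  have ccv: "Ck k f \<Longrightarrow> continuous_on (UNIV \<times> {-pi..pi}) (\<lambda>p. f (fst p) (snd p))" for k f
    using Ck_continuous[of k f] by (simp add: case_prod_beta)
  have C0: "Ck 0 (dy (dy u))" "Ck 0 (dy (dy v))"
    using C1 by simp_all
  \<comment> \<open>This is the elimination of the pressure: \<open>?A\<close> and \<open>?B\<close>
    are the partials of \<open>P\<close>, so the x-derivative of \<open>?B\<close> equals the
    y-derivative \<open>Ay\<close> of \<open>?A\<close>. Uniqueness of derivatives then identifies
    \<open>Ay\<close> with \<open>Bx\<close>.\<close>
  have B': "has_dx ?B Ay"
    by (rule mixed_partials_eq[OF PA PB A])
       (unfold Ay_def case_prod_beta,
        (intro continuous_intros C2[THEN ccv] C1[THEN ccv] C0[THEN ccv])+)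
  have "Ay x y = Bx x y"
    using dx_eq[OF B' y] dx_eq[OF B y] by simp
  then show ?thesis
    unfolding Ay_def Bx_def div[OF y] by (simp add: algebra_simps)
qed

lemma near_kolmogorov_imp_shear:
  assumes sol: "traveling_wave_solution L c u v" and L: "L > 0" and u: "Ck 2 u" and v: "Ck 2 v"
    and c: "c \<in> {..-\<delta>} \<union> {\<delta>..}"
    and near: "Ck_norm 2 (\<lambda>x y. u x y - u_kol x y) < ennreal \<delta>"
  shows "shear_flow (traveling c v)"
proof -
  note C2 = u[unfolded numeral_2_eq_2] v[unfolded numeral_2_eq_2]
  have C1: "Ck 1 (dx u)" "Ck 1 (dy u)" "Ck 1 (dx v)" "Ck 1 (dy v)"
    using C2 by simp_all
  have C0: "Ck 0 (dx (dx u))" "Ck 0 (dy (dy u))" "Ck 0 (dx (dx v))" "Ck 0 (dy (dy v))"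
    using C1 by simp_all
  note cont = C2[THEN Ck_continuous] C1[THEN Ck_continuous] C0[THEN Ck_continuous]
  note dx = C2[THEN Ck_Suc_has_dx] C1[unfolded One_nat_def, THEN Ck_Suc_has_dx]
  note dy = C2[THEN Ck_Suc_has_dy] C1[unfolded One_nat_def, THEN Ck_Suc_has_dy]
  note sol0 = traveling_wave_solutionD(1-4)[OF sol]
  note div = traveling_wave_solutionD(5)[OF sol]
  define w where "w = (\<lambda>x y. u x y - c)"
  define g where "g = (\<lambda>x y. dx (dx u) x y + dy (dy u) x y + u x y)"
  define h where "h = (\<lambda>x y. (dx (dx v) x y + dy (dy v) x y + v x y) / (g x y - c))"
  have g: "\<bar>g x y\<bar> < \<delta>" if y: "y \<in> {-pi..pi}" for x y
  proof -
    let ?f = "\<lambda>x y. u x y - u_kol x y"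
    have f1: "has_dx ?f (dx u)" "has_dy ?f (\<lambda>x y. dy u x y - cos y)"
      unfolding has_dx_def has_dy_def u_kol_def
      by (auto intro!: derivative_eq_intros dx(1)[THEN has_dxD] dy(1)[THEN has_dyD])
    have "has_dx (dx ?f) (dx (dx u))"
      by (rule has_dx_cong[OF dx(3)]) (simp_all add: dx_eq[OF f1(1)])
    then have fxx: "dx (dx ?f) x y = dx (dx u) x y"
      by (rule dx_eq) (rule y)
    have "has_dy (\<lambda>x y. dy u x y - cos y) (\<lambda>x y. dy (dy u) x y + sin y)"
      unfolding has_dy_def by (auto intro!: derivative_eq_intros dy(4)[THEN has_dyD])
    then have "has_dy (dy ?f) (\<lambda>x y. dy (dy u) x y + sin y)"
      by (rule has_dy_cong) (simp_all add: dy_eq[OF f1(2)])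
    then have fyy: "dy (dy ?f) x y = dy (dy u) x y + sin y"
      by (rule dy_eq) (rule y)
    have "ennreal (\<bar>?f x y\<bar> + \<bar>dx (dx ?f) x y\<bar> + \<bar>dy (dy ?f) x y\<bar>) < ennreal \<delta>"
      by (rule le_less_trans[OF Ck_norm_2_ge[OF y] near])
    then have "\<bar>?f x y\<bar> + \<bar>dx (dx ?f) x y\<bar> + \<bar>dy (dy ?f) x y\<bar> < \<delta>"
      by (subst (asm) ennreal_less_iff) auto
    \<comment> \<open>The sine subtracted in \<open>?f\<close> cancels against the one in its second
      y-derivative, so \<open>g\<close> depends on the perturbation alone.\<close>
    moreover have "g x y = ?f x y + dx (dx ?f) x y + dy (dy ?f) x y"
      unfolding fxx fyy by (simp add: g_def u_kol_def)
    ultimately show ?thesis by linarith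
  qed
  have gc: "g x y - c \<noteq> 0" if "y \<in> {-pi..pi}" for x y
    using g[OF that, of x] c by auto
  have elliptic: "w x y * (dx (dx v) x y + dy (dy v) x y)
      = v x y * (dx (dx u) x y + dy (dy u) x y)" if "y \<in> {-pi..pi}" for x y
    unfolding w_def by (rule traveling_wave_vorticity[OF sol u v that])
  \<comment> \<open>\<open>g - c\<close> never vanishes, so \<open>v\<close> is divisible by \<open>w\<close> even across stagnation points.\<close>
  have vwh: "v x y = w x y * h x y" if y: "y \<in> {-pi..pi}" for x y
  proof -
    have "v x y * (g x y - c) = w x y * (dx (dx v) x y + dy (dy v) x y + v x y)"
      using elliptic[OF y, of x] by (simp add: g_def w_def algebra_simps)
    then show ?thesis
      using gc[OF y, of x] by (simp add: h_def eq_divide_eq)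
  qed
  have cw: "continuous_on_channel w"
    unfolding w_def case_prod_beta
    by (intro continuous_intros cont[THEN continuous_on_channel_iff[THEN iffD1]])
  have ch: "continuous_on_channel h"
    unfolding h_def case_prod_beta using gc unfolding g_def
    by (intro continuous_intros cont[THEN continuous_on_channel_iff[THEN iffD1]]) auto
  have w: "has_dx w (dx u)" "has_dy w (dy u)"
    unfolding has_dx_def has_dy_def w_def
    by (auto intro!: derivative_eq_intros dx(1)[THEN has_dxD] dy(1)[THEN has_dyD])
  have per: "periodic_x L w"
    using sol0(1) by (simp add: periodic_x_def w_def)
  have rigid: "w x y * dx v x y = v x y * dx u x y" if y: "y \<in> {-pi..pi}" for x y
    by (rule ratio_rigidity(1)[OF w dx(3) dy(4) dx(2) dy(2) dx(5) dy(6) cw cont(3,4,7,8)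
          cont(2,5,6,9,10) ch _ _ per sol0(2,3,4) L y])
       (fact vwh elliptic)+
  have "v x y = 0" if y: "y \<in> {-pi..pi}" for x y
  proof (rule straight_streamlines_imp_shear[OF w(1) dx(2) dy(2) cw cont(3,2,5,6) div _ per
        sol0(2,3,4) L y])
    fix x y :: real assume y: "y \<in> {-pi..pi}"
    \<comment> \<open>Rigidity turns the advection of \<open>v\<close> into \<open>v\<close> times
      the divergence.\<close>
    have "w x y * dx v x y + v x y * dy v x y = v x y * (dx u x y + dy v x y)"
      using rigid[OF y, of x] by (simp add: algebra_simps)
    then show "w x y * dx v x y + v x y * dy v x y = 0"
      by (simp add: div[OF y])
  qed
  then show ?thesis
    by (simp add: shear_flow_def traveling_def)
qed

section \<open>The explicit steady flows\<close>

text \<open>Congruence at level \<open>k\<close> is an assumption because \<open>Ck_cong\<close> is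
  itself proved through this rule, with its induction hypothesis in that place.\<close>

lemma Ck_SucI:
  assumes f: "has_dx f f'" "has_dy f f''" "continuous_on_channel f" and k: "Ck k f'" "Ck k f''"
    and cong: "\<And>f g. \<lbrakk>Ck k f; \<And>x y. y \<in> {-pi..pi} \<Longrightarrow> f x y = g x y\<rbrakk> \<Longrightarrow> Ck k g"
  shows "Ck (Suc k) f"
proof -
  have "has_partials f"
    using f(1,2) unfolding has_partials_def has_dx_def has_dy_def real_differentiable_def by blast
  moreover have "Ck k (dx f)" "Ck k (dy f)"
    using cong[OF k(1), of "dx f"] cong[OF k(2), of "dy f"]
    by (simp_all add: dx_eq[OF f(1)] dy_eq[OF f(2)])
  ultimately show ?thesis using f(3) by simp
qed

lemma Ck_cong:
  assumes "Ck k f" and "\<And>x y. y \<in> {-pi..pi} \<Longrightarrow> f x y = g x y"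
  shows "Ck k g"
  using assms
proof (induction k arbitrary: f g)
  case 0
  then show ?case
    by (auto elim!: continuous_on_eq)
next
  case (Suc k)
  have g: "has_dx g (dx f)" "has_dy g (dy f)"
    by (rule has_dx_cong[OF Ck_Suc_has_dx] has_dy_cong[OF Ck_Suc_has_dy], rule Suc.prems;
        simp add: Suc.prems(2))+
  have "continuous_on_channel g"
    using Suc.prems by (auto elim!: continuous_on_eq)
  moreover have "Ck k (dx f)" "Ck k (dy f)"
    using Suc.prems(1) by auto
  ultimately show ?case
    by (rule Ck_SucI[OF g]) (erule Suc.IH, blast)
qed

text \<open>The derivatives may be any witnesses, so closure under sums and products follows by
  induction without computing \<open>dx\<close> or \<open>dy\<close>.\<close>

lemma Ck_Suc_iff:
  "Ck (Suc k) f \<longleftrightarrow> continuous_on_channel f \<and>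
     (\<exists>f' f''. has_dx f f' \<and> has_dy f f'' \<and> Ck k f' \<and> Ck k f'')"
proof
  assume "Ck (Suc k) f"
  then show "continuous_on_channel f \<and>
      (\<exists>f' f''. has_dx f f' \<and> has_dy f f'' \<and> Ck k f' \<and> Ck k f'')"
    using Ck_Suc_has_dx[of k f] Ck_Suc_has_dy[of k f] by auto
qed (blast intro: Ck_SucI Ck_cong)

lemma Ck_Suc_imp_Ck: "Ck (Suc k) f \<Longrightarrow> Ck k f"
proof (induction k arbitrary: f)
  case (Suc k)
  have "Ck k (dx f)" "Ck k (dy f)"
    using Suc.prems by (auto intro!: Suc.IH simp only: Ck.simps)
  with Suc.prems show ?case
    unfolding Ck.simps by blast
qed simp

lemma Ck_add:
  assumes "Ck k f" "Ck k g"
  shows "Ck k (\<lambda>x y. f x y + g x y)"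
  using assms
proof (induction k arbitrary: f g)
  case 0
  then show ?case
    by (simp add: continuous_on_channel_iff continuous_intros)
next
  case (Suc k)
  obtain f' f'' where f: "has_dx f f'" "has_dy f f''" "Ck k f'" "Ck k f''" "continuous_on_channel f"
    using Suc.prems(1) unfolding Ck_Suc_iff by blast
  obtain g' g'' where g: "has_dx g g'" "has_dy g g''" "Ck k g'" "Ck k g''" "continuous_on_channel g"
    using Suc.prems(2) unfolding Ck_Suc_iff by blast
  have "has_dx (\<lambda>x y. f x y + g x y) (\<lambda>x y. f' x y + g' x y)"
    using f(1) g(1) by (auto simp: has_dx_def intro!: derivative_intros)
  moreover have "has_dy (\<lambda>x y. f x y + g x y) (\<lambda>x y. f'' x y + g'' x y)"
    using f(2) g(2) by (auto simp: has_dy_def intro!: derivative_intros)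
  moreover have "continuous_on_channel (\<lambda>x y. f x y + g x y)"
    using f(5) g(5) unfolding continuous_on_channel_iff by (intro continuous_intros)
  ultimately show ?case
    unfolding Ck_Suc_iff using Suc.IH[OF f(3) g(3)] Suc.IH[OF f(4) g(4)] by blast
qed

lemma Ck_mult:
  assumes "Ck k f" "Ck k g"
  shows "Ck k (\<lambda>x y. f x y * g x y)"
  using assms
proof (induction k arbitrary: f g)
  case 0
  then show ?case
    by (simp add: continuous_on_channel_iff continuous_intros)
next
  case (Suc k)
  obtain f' f'' where f: "has_dx f f'" "has_dy f f''" "Ck k f'" "Ck k f''" "continuous_on_channel f"
    using Suc.prems(1) unfolding Ck_Suc_iff by blast
  obtain g' g'' where g: "has_dx g g'" "has_dy g g''" "Ck k g'" "Ck k g''" "continuous_on_channel g"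
    using Suc.prems(2) unfolding Ck_Suc_iff by blast
  \<comment> \<open>The product rule leaves one factor undifferentiated, and the induction
    hypothesis needs that factor at level \<open>k\<close>.\<close>
  note k = Suc.prems[THEN Ck_Suc_imp_Ck]
  have "has_dx (\<lambda>x y. f x y * g x y) (\<lambda>x y. f' x y * g x y + f x y * g' x y)"
    unfolding has_dx_def by (auto intro!: derivative_eq_intros has_dxD[OF f(1)] has_dxD[OF g(1)])
  moreover have "has_dy (\<lambda>x y. f x y * g x y) (\<lambda>x y. f'' x y * g x y + f x y * g'' x y)"
    unfolding has_dy_def by (auto intro!: derivative_eq_intros has_dyD[OF f(2)] has_dyD[OF g(2)])
  moreover have "continuous_on_channel (\<lambda>x y. f x y * g x y)"
    using f(5) g(5) unfolding continuous_on_channel_iff by (intro continuous_intros)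
  moreover have "Ck k (\<lambda>x y. f' x y * g x y + f x y * g' x y)"
    by (intro Ck_add Suc.IH f(3) g(3) k)
  moreover have "Ck k (\<lambda>x y. f'' x y * g x y + f x y * g'' x y)"
    by (intro Ck_add Suc.IH f(4) g(4) k)
  ultimately show ?case
    unfolding Ck_Suc_iff by blast
qed

section \<open>Products of sines and their analytic norms\<close>

definition mode :: "real \<Rightarrow> real \<Rightarrow> real \<Rightarrow> real \<Rightarrow> real \<Rightarrow> real \<Rightarrow> real \<Rightarrow> real" where
  "mode A a b c d = (\<lambda>x y. A * sin (a * x + b) * sin (c * y + d))"

text \<open>Differentiating a sine multiplies by the frequency and shifts the phase by a quarter
  period. The family \<open>mode\<close> is therefore closed under both partial derivatives.\<close>

lemma has_dx_mode: "has_dx (mode A a b c d) (mode (A * a) a (b + pi / 2) c d)"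
  unfolding has_dx_def mode_def add.assoc[symmetric] sin_add[of _ "pi / 2"]
  by (auto intro!: derivative_eq_intros)

lemma has_dy_mode: "has_dy (mode A a b c d) (mode (A * c) a b c (d + pi / 2))"
  unfolding has_dy_def mode_def add.assoc[symmetric] sin_add[of _ "pi / 2"]
  by (auto intro!: derivative_eq_intros)

lemma Ck_mode: "Ck k (mode A a b c d)"
proof (induction k arbitrary: A b d)
  case 0
  show ?case
    by (simp add: continuous_on_channel_iff mode_def continuous_intros)
next
  case (Suc k)
  have "continuous_on_channel (mode A a b c d)"
    by (simp add: continuous_on_channel_iff mode_def continuous_intros)
  then show ?case
    unfolding Ck_Suc_iff using has_dx_mode has_dy_mode Suc.IH by blast
qed

lemma Ck_const: "Ck k (\<lambda>x y. c)"
  \<comment> \<open>Frequency 0 and phase \<open>pi / 2\<close> make both sine factors equal to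
    1.\<close>
  using Ck_mode[of k c 0 "pi / 2" 0 "pi / 2"] by (simp add: mode_def)

lemma iterated_partials_mode:
  assumes "y \<in> {-pi..pi}"
  shows "(dx ^^ i) ((dy ^^ j) (mode A a b c d)) x y
    = mode (A * a ^ i * c ^ j) a (b + i * (pi / 2)) c (d + j * (pi / 2)) x y"
  using assms
proof (induction i arbitrary: x y)
  case 0
  then show ?case
  proof (induction j arbitrary: x y)
    case (Suc j)
    have "has_dy ((dy ^^ j) (mode A a b c d))
        (mode (A * c ^ j * c) a b c (d + j * (pi / 2) + pi / 2))"
      using Suc.IH by (intro has_dy_cong[OF has_dy_mode[of "A * c ^ j"]]) auto
    from dy_eq[OF this Suc.prems] show ?case
      by (simp add: algebra_simps add_divide_distrib)
  qed simp
next
  case (Suc i)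
  let ?f = "(dx ^^ i) ((dy ^^ j) (mode A a b c d))"
  have "has_dx ?f (mode (A * a ^ i * c ^ j * a) a (b + i * (pi / 2) + pi / 2) c (d + j * (pi / 2)))"
    using Suc.IH by (intro has_dx_cong[OF has_dx_mode[of "A * a ^ i * c ^ j"]]) auto
  from dx_eq[OF this Suc.prems] show ?case
    by (simp add: algebra_simps add_divide_distrib)
qed

lemma sup_norm_iterated_partials_mode_le:
  "sup_norm ((dx ^^ i) ((dy ^^ j) (mode A a b c d))) \<le> ennreal (\<bar>A\<bar> * \<bar>a\<bar> ^ i * \<bar>c\<bar> ^ j)"
proof (rule sup_norm_le)
  fix x y :: real assume y: "y \<in> {-pi..pi}"
  have "\<bar>B * sin s * sin t\<bar> \<le> \<bar>B\<bar>" for B s t :: real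
    using mult_mono[of "\<bar>sin s\<bar>" 1 "\<bar>sin t\<bar>" 1] mult_left_mono[of "\<bar>sin s\<bar> * \<bar>sin t\<bar>" 1 "\<bar>B\<bar>"]
    by (simp add: abs_mult mult.assoc)
  from this[of "A * a ^ i * c ^ j"]
  show "\<bar>(dx ^^ i) ((dy ^^ j) (mode A a b c d)) x y\<bar> \<le> \<bar>A\<bar> * \<bar>a\<bar> ^ i * \<bar>c\<bar> ^ j"
    unfolding iterated_partials_mode[OF y] unfolding mode_def by (simp add: abs_mult power_abs)
qed

text \<open>The derivative of multi-index (i, j) is bounded by
  \<open>\<bar>A\<bar> * \<bar>a\<bar> ^ i * \<bar>c\<bar> ^ j\<close>, so the weighted double
  series is dominated by a product of two exponential series, finite for every
  \<open>r\<close>.\<close>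

lemma analytic_norm_mode_le:
  assumes r: "r > 0"
  shows "analytic_norm r (mode A a b c d) \<le> ennreal (\<bar>A\<bar> * exp (r * \<bar>a\<bar>) * exp (r * \<bar>c\<bar>))"
proof -
  have exp_sum: "(\<Sum>n. ennreal (B * (s ^ n / fact n))) = ennreal (B * exp s)"
    if "B \<ge> 0" "s \<ge> 0" for B s :: real
    using that sums_mult[OF exp_converges[of s], of B]
    by (intro suminf_ennreal_eq) (auto simp: divide_inverse mult.commute scaleR_conv_of_real)
  have "analytic_norm r (mode A a b c d) \<le> (\<Sum>i. \<Sum>j. ennreal
      (\<bar>A\<bar> * ((r * \<bar>a\<bar>) ^ i / fact i) * ((r * \<bar>c\<bar>) ^ j / fact j)))"
    unfolding analytic_norm_def
  proof (intro suminf_le allI)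
    fix i j
    have "ennreal (r ^ (i + j) / (fact i * fact j)) * sup_norm ((dx ^^ i) ((dy ^^ j) (mode A a b c d)))
        \<le> ennreal (r ^ (i + j) / (fact i * fact j)) * ennreal (\<bar>A\<bar> * \<bar>a\<bar> ^ i * \<bar>c\<bar> ^ j)"
      by (intro mult_left_mono sup_norm_iterated_partials_mode_le) simp
    also have "\<dots> = ennreal (\<bar>A\<bar> * ((r * \<bar>a\<bar>) ^ i / fact i) * ((r * \<bar>c\<bar>) ^ j / fact j))"
      using r by (simp add: ennreal_mult[symmetric] power_add power_mult_distrib algebra_simps)
    finally show "ennreal (r ^ (i + j) / (fact i * fact j))
        * sup_norm ((dx ^^ i) ((dy ^^ j) (mode A a b c d)))
        \<le> ennreal (\<bar>A\<bar> * ((r * \<bar>a\<bar>) ^ i / fact i) * ((r * \<bar>c\<bar>) ^ j / fact j))" .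
  qed auto
  also have "\<dots> = (\<Sum>i. ennreal ((\<bar>A\<bar> * exp (r * \<bar>c\<bar>)) * ((r * \<bar>a\<bar>) ^ i / fact i)))"
    using r by (subst exp_sum) (auto simp: mult_ac)
  also have "\<dots> = ennreal (\<bar>A\<bar> * exp (r * \<bar>c\<bar>) * exp (r * \<bar>a\<bar>))"
    using r by (subst exp_sum) auto
  finally show ?thesis by (simp add: mult_ac)
qed

section \<open>Stream function, pressure and smallness of the explicit flows\<close>

lemma u_eps_eq_mode:
  "u_eps e = (\<lambda>x y. mode 1 0 (pi / 2) 1 0 x y + mode (e / 2) (sqrt 3 / 2) 0 (1 / 2) 0 x y)"
  by (intro ext) (simp add: u_eps_def mode_def)

lemma v_eps_eq_mode: "v_eps e = mode (sqrt 3 * e / 2) (sqrt 3 / 2) (pi / 2) (1 / 2) (pi / 2)"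
  by (intro ext) (simp add: v_eps_def mode_def sin_add)

lemma Ck_u_eps: "Ck k (u_eps e)"
  unfolding u_eps_eq_mode by (intro Ck_add Ck_mode)

lemma Ck_v_eps: "Ck k (v_eps e)"
  unfolding v_eps_eq_mode by (rule Ck_mode)

text \<open>The stream function: its y-derivative is \<open>u_eps e\<close> and its x-derivative is
  \<open>- v_eps e\<close>. Both wave vectors, (0, 1) and (sqrt 3 / 2, 1 / 2), have length 1, hence
  the common eigenvalue -1 of the Laplacian.\<close>

definition psi_eps :: "real \<Rightarrow> real \<Rightarrow> real \<Rightarrow> real" where
  "psi_eps e x y = - cos y - e * cos (y / 2) * sin (sqrt 3 / 2 * x)"

text \<open>
  Since \<open>\<Delta>\<psi> = -\<psi>\<close>, the vorticity term \<open>\<Delta>\<psi> \<nabla>\<psi>\<close> of the Euler equations is the gradient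
  of \<open>-\<psi>\<^sup>2/2\<close>, which joins the Bernoulli term in the pressure.
\<close>

definition p_eps :: "real \<Rightarrow> real \<Rightarrow> real \<Rightarrow> real" where
  "p_eps e x y = - ((u_eps e x y)\<^sup>2 + (v_eps e x y)\<^sup>2 + (psi_eps e x y)\<^sup>2) / 2"

lemma Ck_p_eps: "Ck k (p_eps e)"
proof -
  have "psi_eps e = (\<lambda>x y. mode (-1) 0 (pi / 2) 1 (pi / 2) x y
      + mode (- e) (sqrt 3 / 2) 0 (1 / 2) (pi / 2) x y)"
    by (intro ext) (simp add: psi_eps_def mode_def sin_add)
  then have psi: "Ck k (psi_eps e)"
    by (simp add: Ck_add Ck_mode)
  have "p_eps e = (\<lambda>x y. (- 1 / 2) * (u_eps e x y * u_eps e x y + v_eps e x y * v_eps e x y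
      + psi_eps e x y * psi_eps e x y))"
    by (intro ext) (simp add: p_eps_def power2_eq_square field_simps)
  then show ?thesis
    by (simp only:) (intro Ck_mult Ck_add Ck_const Ck_u_eps Ck_v_eps psi)
qed

lemma steady_solution_eps: "steady_solution L0 (u_eps e) (v_eps e)"
proof -
  define a where "a = sqrt 3 / 2"
  have aa: "a * (a * z) = 3 / 4 * z" for z
    by (simp add: a_def mult.assoc[symmetric])
  have "a * L0 = 2 * pi"
    by (simp add: a_def L0_def)
  then have per: "sin (a * (x + L0)) = sin (a * x)" "cos (a * (x + L0)) = cos (a * x)" for x
    by (simp_all add: distrib_left)
  let ?s = "\<lambda>x. sin (a * x)" and ?c = "\<lambda>x. cos (a * x)"
  have u: "u_eps e = (\<lambda>x y. sin y + e / 2 * sin (y / 2) * ?s x)"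
    and v: "v_eps e = (\<lambda>x y. a * e * cos (y / 2) * ?c x)"
    and psi: "psi_eps e = (\<lambda>x y. - cos y - e * cos (y / 2) * ?s x)"
    by (intro ext; simp add: u_eps_def v_eps_def psi_eps_def a_def)+
  let ?ux = "\<lambda>x y. e / 2 * sin (y / 2) * (a * ?c x)"
    and ?uy = "\<lambda>x y. cos y + e / 4 * cos (y / 2) * ?s x"
    and ?vx = "\<lambda>x y. - 3 / 4 * e * cos (y / 2) * ?s x"
    and ?vy = "\<lambda>x y. - (a * e / 2 * sin (y / 2) * ?c x)"
  have ux: "has_dx (u_eps e) ?ux" and uy: "has_dy (u_eps e) ?uy"
    and vx: "has_dx (v_eps e) ?vx" and vy: "has_dy (v_eps e) ?vy"
    and psix: "has_dx (psi_eps e) (\<lambda>x y. - v_eps e x y)"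
    and psiy: "has_dy (psi_eps e) (u_eps e)"
    unfolding has_dx_def has_dy_def u v psi
    by (auto intro!: derivative_eq_intros simp: aa algebra_simps)
  \<comment> \<open>The vorticity is -\<Delta>\<psi> = \<psi>. Used from right to left below, this
    turns both momentum equations into polynomial identities.\<close>
  have psi_vort: "?vx x y - ?uy x y = psi_eps e x y" for x y
    by (simp add: psi algebra_simps)
  have px: "has_dx (p_eps e) (\<lambda>x y. - (u_eps e x y * ?ux x y + v_eps e x y * ?vx x y
      - psi_eps e x y * v_eps e x y))"
    unfolding has_dx_def p_eps_def power2_eq_square
    by (auto intro!: derivative_eq_intros has_dxD[OF ux] has_dxD[OF vx] has_dxD[OF psix])
  have py: "has_dy (p_eps e) (\<lambda>x y. - (u_eps e x y * ?uy x y + v_eps e x y * ?vy x y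
      + psi_eps e x y * u_eps e x y))"
    unfolding has_dy_def p_eps_def power2_eq_square
    by (auto intro!: derivative_eq_intros has_dyD[OF uy] has_dyD[OF vy] has_dyD[OF psiy])
  have "periodic_x L0 (u_eps e)" "periodic_x L0 (v_eps e)" "periodic_x L0 (p_eps e)"
    by (simp_all add: periodic_x_def p_eps_def u v psi per)
  moreover have "dx (u_eps e) x y + dy (v_eps e) x y = 0" if "y \<in> {-pi..pi}" for x y
    using that by (simp add: dx_eq[OF ux] dy_eq[OF vy])
  moreover have "v_eps e x (-pi) = 0" "v_eps e x pi = 0" for x
    by (simp_all add: v)
  moreover have "u_eps e x y * dx (u_eps e) x y + v_eps e x y * dy (u_eps e) x y
      = - dx (p_eps e) x y" if y: "y \<in> {-pi..pi}" for x y
    unfolding dx_eq[OF ux y] dy_eq[OF uy y] dx_eq[OF px y] psi_vort[symmetric, of x y]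
    by (simp only: algebra_simps)
  moreover have "u_eps e x y * dx (v_eps e) x y + v_eps e x y * dy (v_eps e) x y
      = - dy (p_eps e) x y" if y: "y \<in> {-pi..pi}" for x y
    unfolding dx_eq[OF vx y] dy_eq[OF vy y] dy_eq[OF py y] psi_vort[symmetric, of x y]
    by (simp only: algebra_simps)
  ultimately show ?thesis
    unfolding steady_solution_def f_plane_solution_def
    using Ck_u_eps Ck_v_eps Ck_p_eps
    by (auto intro!: exI[of _ "\<lambda>t. p_eps e"] simp del: Ck.simps One_nat_def)
qed

lemma analytic_norm_eps_small:
  fixes r \<eta> :: real
  assumes r: "r > 0" and \<eta>: "\<eta> > 0"
  shows "\<exists>\<epsilon>\<^sub>0>0. \<forall>\<epsilon>::real. \<bar>\<epsilon>\<bar> < \<epsilon>\<^sub>0 \<longrightarrow>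
        analytic_norm r (\<lambda>x y. u_eps \<epsilon> x y - u_kol x y)
          + analytic_norm r (\<lambda>x y. v_eps \<epsilon> x y - 0) < ennreal \<eta>"
proof -
  \<comment> \<open>The perturbation is linear in \<open>e\<close>: 1/2 and sqrt 3 / 2 are the
    amplitudes of its two components per unit \<open>e\<close>, and the exponentials come from their
    common frequencies. The threshold is then \<open>\<eta> / M\<close>.\<close>
  define M where "M = (1 / 2 + sqrt 3 / 2) * exp (r * (sqrt 3 / 2)) * exp (r * (1 / 2))"
  have M: "M > 0"
    by (auto simp: M_def intro!: mult_pos_pos add_pos_pos)
  have "analytic_norm r (\<lambda>x y. u_eps e x y - u_kol x y) + analytic_norm r (\<lambda>x y. v_eps e x y - 0)
      < ennreal \<eta>" if e: "\<bar>e\<bar> < \<eta> / M" for e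
  proof -
    have "(\<lambda>x y. u_eps e x y - u_kol x y) = mode (e / 2) (sqrt 3 / 2) 0 (1 / 2) 0"
      by (intro ext) (simp add: u_eps_def u_kol_def mode_def)
    moreover have "(\<lambda>x y. v_eps e x y - 0) = mode (sqrt 3 * e / 2) (sqrt 3 / 2) (pi / 2) (1 / 2) (pi / 2)"
      by (simp add: v_eps_eq_mode)
    ultimately have "analytic_norm r (\<lambda>x y. u_eps e x y - u_kol x y)
        + analytic_norm r (\<lambda>x y. v_eps e x y - 0)
        \<le> ennreal (\<bar>e / 2\<bar> * exp (r * \<bar>sqrt 3 / 2\<bar>) * exp (r * \<bar>1 / 2\<bar>))
          + ennreal (\<bar>sqrt 3 * e / 2\<bar> * exp (r * \<bar>sqrt 3 / 2\<bar>) * exp (r * \<bar>1 / 2\<bar>))"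
      by (simp only:) (intro add_mono analytic_norm_mode_le r)
    also have "\<dots> = ennreal (\<bar>e\<bar> * M)"
      by (subst ennreal_plus[symmetric]) (auto simp: M_def abs_mult algebra_simps)
    also have "\<dots> < ennreal \<eta>"
      using e M \<eta> by (intro ennreal_lessI) (auto simp: field_simps)
    finally show ?thesis .
  qed
  then show ?thesis
    using M \<eta> by (intro exI[of _ "\<eta> / M"]) auto
qed

theorem proposition6p11:
  shows
    "(\<forall>\<delta>::real. \<forall>c::real. \<forall>u v :: real \<Rightarrow> real \<Rightarrow> real.
        \<delta> > 0 \<longrightarrow>
        traveling_wave_solution L0 c u v \<longrightarrow>
        Ck 2 u \<longrightarrow> Ck 2 v \<longrightarrow>
        c \<in> {..-\<delta>} \<union> {\<delta>..} \<longrightarrow>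
        Ck_norm 2 (\<lambda>x y. u x y - u_kol x y) < ennreal \<delta> \<longrightarrow>
        shear_flow (traveling c v))
     \<and>
     (\<forall>\<epsilon>::real.
        steady_solution L0 (u_eps \<epsilon>) (v_eps \<epsilon>) \<and>
        (\<epsilon> \<noteq> 0 \<longrightarrow> \<not> shear_flow (\<lambda>t. v_eps \<epsilon>)))
     \<and>
     (\<forall>\<epsilon>::real. \<forall>k. Ck k (u_eps \<epsilon>) \<and> Ck k (v_eps \<epsilon>))
     \<and>
     (\<forall>r>0. \<forall>\<eta>>0. \<exists>\<epsilon>\<^sub>0>0. \<forall>\<epsilon>::real. \<bar>\<epsilon>\<bar> < \<epsilon>\<^sub>0 \<longrightarrow>
        analytic_norm r (\<lambda>x y. u_eps \<epsilon> x y - u_kol x y)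
          + analytic_norm r (\<lambda>x y. v_eps \<epsilon> x y - 0) < ennreal \<eta>)"
proof (intro conjI allI impI)
  have "L0 > 0" by (simp add: L0_def)
  then show "shear_flow (traveling c v)"
    if "traveling_wave_solution L0 c u v" "Ck 2 u" "Ck 2 v" "c \<in> {..-\<delta>} \<union> {\<delta>..}"
      "Ck_norm 2 (\<lambda>x y. u x y - u_kol x y) < ennreal \<delta>" for \<delta> c u v
    using near_kolmogorov_imp_shear that by blast
  show "steady_solution L0 (u_eps \<epsilon>) (v_eps \<epsilon>)" for \<epsilon>
    by (rule steady_solution_eps)
  show "\<not> shear_flow (\<lambda>t. v_eps \<epsilon>)" if "\<epsilon> \<noteq> 0" for \<epsilon>
  proof
    assume "shear_flow (\<lambda>t. v_eps \<epsilon>)"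
    \<comment> \<open>At the origin both cosines equal 1, leaving the amplitude of
      \<open>v_eps \<epsilon>\<close>.\<close>
    then have "v_eps \<epsilon> 0 0 = 0" by (simp add: shear_flow_def)
    then show False using that by (simp add: v_eps_def)
  qed
qed (fact Ck_u_eps Ck_v_eps analytic_norm_eps_small)+

end
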